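(* Let $\mathfrak g_4$ be the complex Lie algebra with basis $\{e_1,e_2,e_3\}$ and only non-zero bracket (up to skew-symmetry) $[e_2,e_3]=e_2$, and let $\{e_1^*,e_2^*,e_3^*\}$ be the dual basis of $\mathfrak g_4^*$. Then the Lie algebra $\mathfrak g_4\ltimes_{\mathrm{ad}^*}\mathfrak g_4^*$ has basis $\{e_1,e_2,e_3,e_1^*,e_2^*,e_3^*\}$ with non-zero brackets (up to skew-symmetry) $$[e_2,e_3]=e_2,\quad [e_2,e_2^*]=-e_3^*,\quad [e_3,e_2^*]=e_2^*.$$ Moreover, for all complex parameters $n_{ij}$ subject to the stated restrictions, each of the following is a solution of the classical Yang–Baxter equation on this Lie algebra: - $r_1=n_{32}e_2\otimes e_3^*-e_3^*\otimes n_{32}e_2$; - $r_2=(n_{22}e_2+n_{23}e_3)\otimes e_2^*-\big(\frac{n_{22}^2}{n_{23}}e_2+n_{22}e_3\big)\otimes e_3^*-e_2^*\otimes(n_{22}e_2+n_{23}e_3)+e_3^*\otimes\big(\frac{n_{22}^2}{n_{23}}e_2+n_{22}e_3\big)$, $n_{23}\neq0$; - $r_3=(n_{31}e_1+n_{32}e_2)\otimes e_3^*-e_3^*\otimes(n_{31}e_1+n_{32}e_2)$, $n_{31}\neq0$; - $r_4=n_{21}e_1\otimes e_2^*+n_{31}e_1\otimes e_3^*-e_2^*\otimes n_{21}e_1-e_3^*\otimes n_{31}e_1$, $n_{21}\neq0$; - $r_5=n_{12}e_2\otimes e_1^*+n_{32}e_2\otimes e_3^*-e_1^*\otimes n_{12}e_2-e_3^*\otimes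 n_{32}e_2$, $n_{12}\neq0$; - $r_6=u\otimes e_2^*+v\otimes e_3^*-e_2^*\otimes u-e_3^*\otimes v$, where $u=n_{21}e_1-n_{31}e_2+n_{21}e_3$, $v=n_{31}e_1-\frac{n_{31}^2}{n_{21}}e_2+n_{31}e_3$, $n_{21}\neq0$.
   Context: For a Lie algebra $\mathfrak g$, the coadjoint representation $\mathrm{ad}^*:\mathfrak g\to\mathfrak{gl}(\mathfrak g^* )$ is $\langle\mathrm{ad}^*_x\xi,y\rangle=-\langle\xi,[x,y]\rangle$, and $\mathfrak g\ltimes_{\mathrm{ad}^*}\mathfrak g^*$ is $\mathfrak g\oplus\mathfrak g^*$ with bracket $[x_1+\xi_1,x_2+\xi_2]=[x_1,x_2]+\mathrm{ad}^*_{x_1}\xi_2-\mathrm{ad}^*_{x_2}\xi_1$. An element $r=\sum_i a_i\otimes b_i\in\mathfrak h\otimes\mathfrak h$ of a Lie algebra $\mathfrak h$ is a solution of the classical Yang–Baxter equation (CYBE) in $\mathfrak h$ if $[r_{12},r_{13}]+[r_{12},r_{23}]+[r_{13},r_{23}]=0$ in $U(\mathfrak h)^{\otimes 3}$, where $r_{12}=\sum_i a_i\otimes b_i\otimes1$, $r_{13}=\sum_i a_i\otimes1\otimes b_i$, $r_{23}=\sum_i1\otimes a_i\otimes b_i$ and $U(\mathfrak h)$ is the universal enveloping algebra. *)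

theory Defs
  imports Complex_Main "HOL-Library.Poly_Mapping"
begin

section \<open>Complex vector spaces, algebras and Lie algebras\<close>

class scaleC =
  fixes scaleC :: "complex \<Rightarrow> 'a \<Rightarrow> 'a" (infixr \<open>*\<^sub>C\<close> 75)

class complex_vector = scaleC + ab_group_add +
  assumes scaleC_add_right: "a *\<^sub>C (x + y) = a *\<^sub>C x + a *\<^sub>C y"
    and scaleC_add_left: "(a + b) *\<^sub>C x = a *\<^sub>C x + b *\<^sub>C x"
    and scaleC_scaleC: "a *\<^sub>C b *\<^sub>C x = (a * b) *\<^sub>C x"
    and scaleC_one: "1 *\<^sub>C x = x"

global_interpretation cvs: vector_space "scaleC :: complex \<Rightarrow> 'a \<Rightarrow> 'a::complex_vector"
  by unfold_locales (simp_all add: scaleC_add_right scaleC_add_left scaleC_scaleC scaleC_one)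

abbreviation clinear :: "('a::complex_vector \<Rightarrow> 'b::complex_vector) \<Rightarrow> bool" where
  "clinear \<equiv> Vector_Spaces.linear scaleC scaleC"

lemma clinear_iff:
  "clinear f \<longleftrightarrow> (\<forall>x y. f (x + y) = f x + f y) \<and> (\<forall>c x. f (c *\<^sub>C x) = c *\<^sub>C f x)"
  unfolding Vector_Spaces.linear_iff
  by (auto intro!: cvs.vector_space_axioms)

lemma clinearI:
  assumes "\<And>x y. f (x + y) = f x + f y" "\<And>c x. f (c *\<^sub>C x) = c *\<^sub>C f x"
  shows "clinear f"
  using assms by (simp add: clinear_iff)

lemma clinear_add: "clinear f \<Longrightarrow> f (x + y) = f x + f y"
  and clinear_scaleC: "clinear f \<Longrightarrow> f (c *\<^sub>C x) = c *\<^sub>C f x"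
  by (simp_all add: clinear_iff)

lemma clinear_zero: "clinear f \<Longrightarrow> f 0 = 0"
  using clinear_scaleC[of f 0 0] by simp

lemma clinear_neg: "clinear f \<Longrightarrow> f (- x) = - f x"
  by (metis add_eq_0_iff clinear_add clinear_zero neg_eq_iff_add_eq_0)

lemma clinear_diff: "clinear f \<Longrightarrow> f (x - y) = f x - f y"
  using clinear_add[of f x "- y"] by (simp add: clinear_neg)

definition cbilinear ::
    "('a::complex_vector \<Rightarrow> 'b::complex_vector \<Rightarrow> 'c::complex_vector) \<Rightarrow> bool" where
  "cbilinear f \<longleftrightarrow> (\<forall>x. clinear (f x)) \<and> (\<forall>y. clinear (\<lambda>x. f x y))"

(* Not a subclass of ring_1, which would also demand that 0 and 1 differ. *)
class complex_algebra_1 = complex_vector + ring + monoid_mult +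
  assumes mult_scaleC_left: "(a *\<^sub>C x) * y = a *\<^sub>C (x * y)"
    and mult_scaleC_right: "x * (a *\<^sub>C y) = a *\<^sub>C (x * y)"

class complex_lie_algebra = complex_vector +
  fixes bracket :: "'a \<Rightarrow> 'a \<Rightarrow> 'a"
  assumes bracket_add_left: "bracket (x + y) z = bracket x z + bracket y z"
    and bracket_add_right: "bracket x (y + z) = bracket x y + bracket x z"
    and bracket_scaleC_left: "bracket (a *\<^sub>C x) y = a *\<^sub>C bracket x y"
    and bracket_scaleC_right: "bracket x (a *\<^sub>C y) = a *\<^sub>C bracket x y"
    and bracket_self: "bracket x x = 0"
    and jacobi: "bracket x (bracket y z) + bracket y (bracket z x) + bracket z (bracket x y) = 0"

lemma bracket_skew: "bracket x y = - bracket y (x::'a::complex_lie_algebra)"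
proof -
  have "bracket (x + y) (x + y) = 0"
    by (rule bracket_self)
  then show ?thesis
    by (metis add.commute add.right_neutral add_0 bracket_add_left bracket_add_right bracket_self
        eq_neg_iff_add_eq_0)
qed

lemma clinear_bracket: "clinear (bracket (x::'a::complex_lie_algebra))"
  by (intro clinearI bracket_add_right bracket_scaleC_right)

instantiation complex :: complex_vector
begin
definition scaleC_complex :: "complex \<Rightarrow> complex \<Rightarrow> complex" where
  "scaleC_complex a x = a * x"
instance
  by standard (simp_all add: scaleC_complex_def algebra_simps)
end


section \<open>The coadjoint representation and the semidirect product\<close>

typedef (overloaded) 'a dual = "{f :: 'a::complex_vector \<Rightarrow> complex. clinear f}"
  morphisms dual_apply Dual
  by (rule exI[of _ "\<lambda>_. 0"]) (simp add: clinear_iff)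

setup_lifting type_definition_dual

lemma clinear_dual_apply: "clinear (dual_apply \<xi>)"
  using dual_apply by blast

lemma dual_eqI: "(\<And>x. dual_apply \<xi> x = dual_apply \<eta> x) \<Longrightarrow> \<xi> = \<eta>"
  by (metis dual_apply_inject ext)

instantiation dual :: (complex_vector) complex_vector
begin
lift_definition zero_dual :: "'a dual" is "\<lambda>_. 0"
  by (simp add: clinear_iff)
lift_definition plus_dual :: "'a dual \<Rightarrow> 'a dual \<Rightarrow> 'a dual" is "\<lambda>f g x. f x + g x"
  by (simp add: clinear_iff scaleC_add_right)
lift_definition minus_dual :: "'a dual \<Rightarrow> 'a dual \<Rightarrow> 'a dual" is "\<lambda>f g x. f x - g x"
  by (simp add: clinear_iff cvs.scale_right_diff_distrib)
lift_definition uminus_dual :: "'a dual \<Rightarrow> 'a dual" is "\<lambda>f x. - f x"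
  by (simp add: clinear_iff)
lift_definition scaleC_dual :: "complex \<Rightarrow> 'a dual \<Rightarrow> 'a dual" is "\<lambda>c f x. c *\<^sub>C f x"
  by (simp add: clinear_iff scaleC_add_right scaleC_scaleC mult.commute)
instance
  by standard
    (transfer; simp add: fun_eq_iff scaleC_add_right scaleC_add_left scaleC_scaleC scaleC_one)+
end

lift_definition coad :: "'a::complex_lie_algebra \<Rightarrow> 'a dual \<Rightarrow> 'a dual"
  is "\<lambda>x \<xi> y. - \<xi> (bracket x y)"
  by (simp add: clinear_iff bracket_add_right bracket_scaleC_right)

lemma coad_add_left: "coad (x + y) \<xi> = coad x \<xi> + coad y \<xi>"
  and coad_add_right: "coad x (\<xi> + \<eta>) = coad x \<xi> + coad x \<eta>"
  and coad_scaleC_left: "coad (c *\<^sub>C x) \<xi> = c *\<^sub>C coad x \<xi>"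
  and coad_scaleC_right: "coad x (c *\<^sub>C \<xi>) = c *\<^sub>C coad x \<xi>"
  by (transfer; simp add: fun_eq_iff clinear_iff bracket_add_left bracket_scaleC_left)+

lemma coad_bracket: "coad (bracket x y) \<xi> = coad x (coad y \<xi>) - coad y (coad x \<xi>)"
proof (rule dual_eqI)
  fix z
  have "bracket (bracket x y) z = bracket x (bracket y z) - bracket y (bracket x z)"
    using jacobi[of x y z] bracket_skew[of z "bracket x y"] bracket_skew[of z x]
    by (simp add: clinear_neg[OF clinear_bracket] algebra_simps)
  then show "dual_apply (coad (bracket x y) \<xi>) z
      = dual_apply (coad x (coad y \<xi>) - coad y (coad x \<xi>)) z"
    by (simp add: coad.rep_eq minus_dual.rep_eq clinear_diff[OF clinear_dual_apply])
qed

(* The semidirect product of g and its dual; Semi x \<xi> stands for x + \<xi>. *)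
context notes [[typedef_overloaded]]
begin
datatype ('a::complex_lie_algebra) semi = Semi (lie_part: 'a) (dual_part: "'a dual")
end

instantiation semi :: (complex_lie_algebra) complex_lie_algebra
begin
definition "0 = Semi 0 0"
definition "p + q = Semi (lie_part p + lie_part q) (dual_part p + dual_part q)"
definition "p - q = Semi (lie_part p - lie_part q) (dual_part p - dual_part q)"
definition "- p = Semi (- lie_part p) (- dual_part p)"
definition "c *\<^sub>C p = Semi (c *\<^sub>C lie_part p) (c *\<^sub>C dual_part p)"
definition "bracket p q = Semi (bracket (lie_part p) (lie_part q))
  (coad (lie_part p) (dual_part q) - coad (lie_part q) (dual_part p))"
instance
proof standard
  fix x y z :: "'a semi"
  have neg: "coad u (\<xi> - \<eta>) = coad u \<xi> - coad u \<eta>" for u :: 'a and \<xi> \<eta>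
    by (metis add_diff_cancel_right' coad_add_right diff_add_cancel)
  show "bracket x (bracket y z) + bracket y (bracket z x) + bracket z (bracket x y) = 0"
    by (simp add: bracket_semi_def plus_semi_def zero_semi_def jacobi neg coad_bracket)
qed (auto simp: zero_semi_def plus_semi_def minus_semi_def uminus_semi_def scaleC_semi_def
       bracket_semi_def semi.expand scaleC_add_left scaleC_add_right scaleC_scaleC scaleC_one
       coad_add_left coad_add_right coad_scaleC_left coad_scaleC_right
       bracket_add_left bracket_add_right bracket_scaleC_left bracket_scaleC_right bracket_self
       cvs.scale_right_diff_distrib)
end

definition of_lie :: "'a::complex_lie_algebra \<Rightarrow> 'a semi" where
  "of_lie x = Semi x 0"

definition of_dual :: "'a::complex_lie_algebra dual \<Rightarrow> 'a semi" where
  "of_dual \<xi> = Semi 0 \<xi>"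


section \<open>The universal enveloping algebra\<close>

datatype 'a word = Word (letters: "'a list")

(* Poly_Mapping writes the monoid of exponents additively: + is concatenation of words,
   so that finitely supported functions on words form the free associative algebra. *)
instantiation word :: (type) monoid_add
begin
definition "0 = Word []"
definition "v + w = Word (letters v @ letters w)"
instance
  by standard (simp_all add: zero_word_def plus_word_def)
end

type_synonym 'a free_alg = "'a word \<Rightarrow>\<^sub>0 complex"

definition gen :: "'a \<Rightarrow> 'a free_alg" where
  "gen x = Poly_Mapping.single (Word [x]) 1"

(* Poly_Mapping.single 0 c is the scalar c.  The first two kinds of generators turn the free
   algebra on the set underlying g into the tensor algebra of the vector space g. *)
inductive_set uea_ideal :: "'a::complex_lie_algebra free_alg set" where
  add: "gen (x + y) - gen x - gen y \<in> uea_ideal"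
| scale: "gen (c *\<^sub>C x) - Poly_Mapping.single 0 c * gen x \<in> uea_ideal"
| comm: "gen x * gen y - gen y * gen x - gen (bracket x y) \<in> uea_ideal"
| zero: "0 \<in> uea_ideal"
| sum: "p \<in> uea_ideal \<Longrightarrow> q \<in> uea_ideal \<Longrightarrow> p + q \<in> uea_ideal"
| left: "p \<in> uea_ideal \<Longrightarrow> q * p \<in> uea_ideal"
| right: "p \<in> uea_ideal \<Longrightarrow> p * q \<in> uea_ideal"

lemma uea_ideal_neg: "p \<in> uea_ideal \<Longrightarrow> - p \<in> uea_ideal"
  using uea_ideal.left[of p "- 1"] by simp

definition uea_rel :: "'a::complex_lie_algebra free_alg \<Rightarrow> 'a free_alg \<Rightarrow> bool" where
  "uea_rel p q \<longleftrightarrow> p - q \<in> uea_ideal"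

lemma uea_rel_equivp: "equivp uea_rel"
proof (rule equivpI)
  show "reflp uea_rel"
    by (simp add: reflp_def uea_rel_def uea_ideal.zero)
  show "symp uea_rel"
    unfolding symp_def uea_rel_def using uea_ideal_neg by fastforce
  show "transp uea_rel"
    unfolding transp_def uea_rel_def using uea_ideal.sum by fastforce
qed

quotient_type (overloaded) 'a uea = "'a::complex_lie_algebra free_alg" / uea_rel
  by (rule uea_rel_equivp)

lemma poly_mapping_induct [case_names single sum]:
  fixes p :: "'k \<Rightarrow>\<^sub>0 'v::comm_monoid_add"
  assumes single: "\<And>k v. P (Poly_Mapping.single k v)"
    and sum: "\<And>f g. P f \<Longrightarrow> P g \<Longrightarrow> P (f + g)"
  shows "P p"
proof (induction p rule: update_induct)
  case const
  show ?case
    using single[of undefined 0] by simp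
next
  case (update f a b)
  have "Poly_Mapping.update a b f = f + Poly_Mapping.single a b"
    using update.hyps(1)
    by (intro poly_mapping_eqI) (auto simp: lookup_update lookup_add lookup_single when_def
        in_keys_iff)
  then show ?case
    using sum[OF update.IH single] by simp
qed

lemma scalar_commute: "p * Poly_Mapping.single 0 c = Poly_Mapping.single 0 c * p"
  for p :: "'a::monoid_add \<Rightarrow>\<^sub>0 complex"
proof (induction p rule: poly_mapping_induct)
  case (single k v)
  then show ?case
    by (simp add: mult_single mult.commute)
next
  case (sum f g)
  then show ?case
    by (simp add: distrib_left distrib_right)
qed

instantiation uea :: (complex_lie_algebra) complex_algebra_1
begin
lift_definition zero_uea :: "'a uea" is 0 .
lift_definition one_uea :: "'a uea" is 1 .
lift_definition plus_uea :: "'a uea \<Rightarrow> 'a uea \<Rightarrow> 'a uea" is "(+)"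
  unfolding uea_rel_def using uea_ideal.sum by (fastforce simp: add_diff_add)
lift_definition uminus_uea :: "'a uea \<Rightarrow> 'a uea" is uminus
  unfolding uea_rel_def using uea_ideal_neg by fastforce
lift_definition minus_uea :: "'a uea \<Rightarrow> 'a uea \<Rightarrow> 'a uea" is "(-)"
proof (unfold uea_rel_def)
  fix p p' q q' :: "'a free_alg"
  assume "p - p' \<in> uea_ideal" "q - q' \<in> uea_ideal"
  then have "(p - p') + - (q - q') \<in> uea_ideal"
    by (intro uea_ideal.sum uea_ideal_neg)
  then show "p - q - (p' - q') \<in> uea_ideal"
    by (simp add: algebra_simps)
qed
lift_definition times_uea :: "'a uea \<Rightarrow> 'a uea \<Rightarrow> 'a uea" is "(*)"
proof (unfold uea_rel_def)
  fix p p' q q' :: "'a free_alg"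
  assume "p - p' \<in> uea_ideal" "q - q' \<in> uea_ideal"
  then have "(p - p') * q + p' * (q - q') \<in> uea_ideal"
    by (intro uea_ideal.sum uea_ideal.left uea_ideal.right)
  then show "p * q - p' * q' \<in> uea_ideal"
    by (simp add: algebra_simps)
qed
lift_definition scaleC_uea :: "complex \<Rightarrow> 'a uea \<Rightarrow> 'a uea"
  is "\<lambda>c p. Poly_Mapping.single 0 c * p"
  unfolding uea_rel_def by (metis right_diff_distrib uea_ideal.left)
instance
proof standard
  fix a b :: complex and x y z :: "'a uea"
  show "a *\<^sub>C (x + y) = a *\<^sub>C x + a *\<^sub>C y"
    by transfer (simp add: distrib_left uea_rel_def uea_ideal.zero)
  show "(a + b) *\<^sub>C x = a *\<^sub>C x + b *\<^sub>C x"
    by transfer (simp add: distrib_right single_add uea_rel_def uea_ideal.zero)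
  show "a *\<^sub>C b *\<^sub>C x = (a * b) *\<^sub>C x"
    by transfer (simp add: mult.assoc[symmetric] mult_single uea_rel_def uea_ideal.zero)
  show "1 *\<^sub>C x = x"
    by transfer (simp add: uea_rel_def uea_ideal.zero)
  show "a *\<^sub>C x * y = a *\<^sub>C (x * y)"
    by transfer (simp add: mult.assoc uea_rel_def uea_ideal.zero)
  show "x * a *\<^sub>C y = a *\<^sub>C (x * y)"
    by transfer (simp add: mult.assoc[symmetric] scalar_commute uea_rel_def uea_ideal.zero)
qed (transfer; simp add: algebra_simps uea_rel_def uea_ideal.zero)+
end

lift_definition uea_embed :: "'a::complex_lie_algebra \<Rightarrow> 'a uea" is gen .

lemma clinear_uea_embed: "clinear uea_embed"
proof (rule clinearI)
  show "uea_embed (x + y) = uea_embed x + uea_embed y" for x y :: 'a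
    by transfer (simp add: uea_rel_def diff_diff_eq[symmetric] uea_ideal.add)
  show "uea_embed (c *\<^sub>C x) = c *\<^sub>C uea_embed x" for c and x :: 'a
    by transfer (simp add: uea_rel_def uea_ideal.scale)
qed

lemma uea_embed_bracket:
  "uea_embed (bracket x y) = uea_embed x * uea_embed y - uea_embed y * uea_embed x"
proof transfer
  fix x y :: 'a
  show "uea_rel (gen (bracket x y)) (gen x * gen y - gen y * gen x)"
    unfolding uea_rel_def using uea_ideal_neg[OF uea_ideal.comm[of x y]] by simp
qed


section \<open>Tensor products\<close>

instantiation poly_mapping :: (type, complex_vector) complex_vector
begin
definition "scaleC_poly_mapping c = Poly_Mapping.map (scaleC c)"

lemma lookup_scaleC: "Poly_Mapping.lookup (c *\<^sub>C p) k = c *\<^sub>C Poly_Mapping.lookup p k"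
  for p :: "'a \<Rightarrow>\<^sub>0 'b"
  by (simp add: scaleC_poly_mapping_def Poly_Mapping.map.rep_eq when_def)

instance
  by standard
    (simp_all add: poly_mapping_eq_iff fun_eq_iff lookup_scaleC lookup_add
      scaleC_add_left scaleC_add_right scaleC_scaleC scaleC_one)
end

(* The element Poly_Mapping.single (a, b) 1 is the basis vector of the free vector space
   indexed by the pair (a, b). *)
definition tensor_relations ::
    "('a::complex_vector \<times> 'b::complex_vector \<Rightarrow>\<^sub>0 complex) set" where
  "tensor_relations = cvs.span
    ({Poly_Mapping.single (a + a', b) 1 - Poly_Mapping.single (a, b) 1
        - Poly_Mapping.single (a', b) 1 | a a' b. True} \<union>
     {Poly_Mapping.single (a, b + b') 1 - Poly_Mapping.single (a, b) 1
        - Poly_Mapping.single (a, b') 1 | a b b'. True} \<union>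
     {Poly_Mapping.single (c *\<^sub>C a, b) 1 - c *\<^sub>C Poly_Mapping.single (a, b) 1 | c a b. True} \<union>
     {Poly_Mapping.single (a, c *\<^sub>C b) 1 - c *\<^sub>C Poly_Mapping.single (a, b) 1 | c a b. True})"

definition tensor_rel ::
    "('a::complex_vector \<times> 'b::complex_vector \<Rightarrow>\<^sub>0 complex) \<Rightarrow> ('a \<times> 'b \<Rightarrow>\<^sub>0 complex) \<Rightarrow> bool" where
  "tensor_rel p q \<longleftrightarrow> p - q \<in> tensor_relations"

lemma tensor_relations_zero: "0 \<in> tensor_relations"
  by (simp add: tensor_relations_def cvs.span_zero)

lemma tensor_relations_add:
  "p \<in> tensor_relations \<Longrightarrow> q \<in> tensor_relations \<Longrightarrow> p + q \<in> tensor_relations"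
  by (simp add: tensor_relations_def cvs.span_add)

lemma tensor_relations_neg: "p \<in> tensor_relations \<Longrightarrow> - p \<in> tensor_relations"
  by (simp add: tensor_relations_def cvs.span_neg)

lemma tensor_relations_scaleC: "p \<in> tensor_relations \<Longrightarrow> c *\<^sub>C p \<in> tensor_relations"
  by (simp add: tensor_relations_def cvs.span_scale)

lemma tensor_rel_equivp: "equivp tensor_rel"
proof (rule equivpI)
  show "reflp tensor_rel"
    by (simp add: reflp_def tensor_rel_def tensor_relations_zero)
  show "symp tensor_rel"
    unfolding symp_def tensor_rel_def using tensor_relations_neg by fastforce
  show "transp tensor_rel"
    unfolding transp_def tensor_rel_def using tensor_relations_add by fastforce
qed

quotient_type (overloaded) ('a, 'b) tensor =
  "'a::complex_vector \<times> 'b::complex_vector \<Rightarrow>\<^sub>0 complex" / tensor_rel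
  by (rule tensor_rel_equivp)

lift_definition tens :: "'a::complex_vector \<Rightarrow> 'b::complex_vector \<Rightarrow> ('a, 'b) tensor"
    (infixl \<open>\<otimes>\<close> 73)
  is "\<lambda>a b. Poly_Mapping.single (a, b) 1" .

instantiation tensor :: (complex_vector, complex_vector) complex_vector
begin
lift_definition zero_tensor :: "('a, 'b) tensor" is 0 .
lift_definition plus_tensor :: "('a, 'b) tensor \<Rightarrow> ('a, 'b) tensor \<Rightarrow> ('a, 'b) tensor" is "(+)"
  unfolding tensor_rel_def using tensor_relations_add by (fastforce simp: add_diff_add)
lift_definition uminus_tensor :: "('a, 'b) tensor \<Rightarrow> ('a, 'b) tensor" is uminus
  unfolding tensor_rel_def using tensor_relations_neg by fastforce
lift_definition minus_tensor :: "('a, 'b) tensor \<Rightarrow> ('a, 'b) tensor \<Rightarrow> ('a, 'b) tensor" is "(-)"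
proof (unfold tensor_rel_def)
  fix p p' q q' :: "'a \<times> 'b \<Rightarrow>\<^sub>0 complex"
  assume "p - p' \<in> tensor_relations" "q - q' \<in> tensor_relations"
  then have "(p - p') + - (q - q') \<in> tensor_relations"
    by (intro tensor_relations_add tensor_relations_neg)
  then show "p - q - (p' - q') \<in> tensor_relations"
    by (simp add: algebra_simps)
qed
lift_definition scaleC_tensor :: "complex \<Rightarrow> ('a, 'b) tensor \<Rightarrow> ('a, 'b) tensor" is scaleC
  unfolding tensor_rel_def by (metis cvs.scale_right_diff_distrib tensor_relations_scaleC)
instance
  by standard
    (transfer; simp add: tensor_rel_def tensor_relations_zero algebra_simps
      scaleC_add_left scaleC_add_right scaleC_scaleC scaleC_one)+
end

lemma tens_add_left: "(a + a') \<otimes> b = a \<otimes> b + a' \<otimes> b"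
  by transfer
    (unfold tensor_rel_def tensor_relations_def diff_diff_eq[symmetric], rule cvs.span_base, blast)

lemma tens_add_right: "a \<otimes> (b + b') = a \<otimes> b + a \<otimes> b'"
  by transfer
    (unfold tensor_rel_def tensor_relations_def diff_diff_eq[symmetric], rule cvs.span_base, blast)

lemma tens_scaleC_left: "(c *\<^sub>C a) \<otimes> b = c *\<^sub>C (a \<otimes> b)"
  by transfer (unfold tensor_rel_def tensor_relations_def, rule cvs.span_base, blast)

lemma tens_scaleC_right: "a \<otimes> (c *\<^sub>C b) = c *\<^sub>C (a \<otimes> b)"
  by transfer (unfold tensor_rel_def tensor_relations_def, rule cvs.span_base, blast)

lemma cbilinear_tens: "cbilinear (\<otimes>)"
  by (simp add: cbilinear_def clinear_iff tens_add_left tens_add_right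
      tens_scaleC_left tens_scaleC_right)

lemma tensor_induct [case_names tens add]:
  assumes tens: "\<And>a b. P (a \<otimes> b)" and add: "\<And>s t. P s \<Longrightarrow> P t \<Longrightarrow> P (s + t)"
  shows "P t"
proof (induction t rule: tensor.abs_induct)
  case (1 p)
  show ?case
  proof (induction p rule: poly_mapping_induct)
    case (single k v)
    have "Poly_Mapping.single k v = v *\<^sub>C Poly_Mapping.single k 1"
      by (intro poly_mapping_eqI) (simp add: lookup_scaleC lookup_single when_def scaleC_complex_def)
    then have "abs_tensor (Poly_Mapping.single k v) = v *\<^sub>C (fst k \<otimes> snd k)"
      by (simp add: tens.abs_eq scaleC_tensor.abs_eq)
    then have "abs_tensor (Poly_Mapping.single k v) = (v *\<^sub>C fst k) \<otimes> snd k"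
      by (simp add: tens_scaleC_left)
    then show ?case
      by (simp add: tens)
  next
    case (sum f g)
    then show ?case
      using add by (metis plus_tensor.abs_eq)
  qed
qed

definition free_extend :: "('k \<Rightarrow> 'c::complex_vector) \<Rightarrow> ('k \<Rightarrow>\<^sub>0 complex) \<Rightarrow> 'c" where
  "free_extend g p = (\<Sum>k\<in>Poly_Mapping.keys p. Poly_Mapping.lookup p k *\<^sub>C g k)"

(* The linear map on the tensor product induced by f; meaningful only for bilinear f. *)
definition tensor_lift ::
    "('a::complex_vector \<Rightarrow> 'b::complex_vector \<Rightarrow> 'c::complex_vector) \<Rightarrow> ('a, 'b) tensor \<Rightarrow> 'c" where
  "tensor_lift f t = free_extend (\<lambda>(a, b). f a b) (rep_tensor t)"

lemma free_extend_superset: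
  assumes "finite S" "Poly_Mapping.keys p \<subseteq> S"
  shows "free_extend g p = (\<Sum>k\<in>S. Poly_Mapping.lookup p k *\<^sub>C g k)"
  unfolding free_extend_def using assms
  by (intro sum.mono_neutral_left) (auto simp: in_keys_iff)

lemma clinear_free_extend: "clinear (free_extend g)"
proof (rule clinearI)
  fix p q :: "'a \<Rightarrow>\<^sub>0 complex" and c
  let ?S = "Poly_Mapping.keys p \<union> Poly_Mapping.keys q"
  show "free_extend g (p + q) = free_extend g p + free_extend g q"
    using Poly_Mapping.keys_add[of p q]
    by (simp add: free_extend_superset[of ?S] lookup_add scaleC_add_left sum.distrib)
  have "Poly_Mapping.keys (c *\<^sub>C p) \<subseteq> Poly_Mapping.keys p"
    by (auto simp: in_keys_iff lookup_scaleC)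
  then show "free_extend g (c *\<^sub>C p) = c *\<^sub>C free_extend g p"
    by (simp add: free_extend_superset[of "Poly_Mapping.keys p"] lookup_scaleC
        scaleC_complex_def scaleC_scaleC cvs.scale_sum_right)
qed

lemma free_extend_single: "free_extend g (Poly_Mapping.single k 1) = g k"
  by (simp add: free_extend_def scaleC_one)

lemma free_extend_relations:
  assumes "cbilinear f" "p \<in> tensor_relations"
  shows "free_extend (\<lambda>(a, b). f a b) p = 0"
proof -
  let ?F = "free_extend (\<lambda>(a, b). f a b)"
  note lin = clinear_free_extend[of "\<lambda>(a, b). f a b"]
  have "cvs.subspace {p. ?F p = 0}"
    by (auto intro!: cvs.subspaceI
        simp: clinear_zero[OF lin] clinear_add[OF lin] clinear_scaleC[OF lin])
  then have "tensor_relations \<subseteq> {p. ?F p = 0}"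
    unfolding tensor_relations_def
    by (rule cvs.span_minimal[rotated])
      (use assms(1) in \<open>auto simp: clinear_diff[OF lin] clinear_scaleC[OF lin]
        free_extend_single cbilinear_def clinear_iff\<close>)
  then show ?thesis
    using assms(2) by auto
qed

lemma tensor_lift_abs:
  assumes "cbilinear f"
  shows "tensor_lift f (abs_tensor p) = free_extend (\<lambda>(a, b). f a b) p"
proof -
  have "tensor_rel (rep_tensor (abs_tensor p)) p"
    using Quotient_rep_abs[OF Quotient_tensor] tensor_rel_equivp
    by (metis equivp_reflp)
  then show ?thesis
    using free_extend_relations[OF assms] clinear_diff[OF clinear_free_extend]
    unfolding tensor_lift_def tensor_rel_def by (metis eq_iff_diff_eq_0)
qed

lemma tensor_lift_tens: "cbilinear f \<Longrightarrow> tensor_lift f (a \<otimes> b) = f a b"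
  by (simp add: tens.abs_eq tensor_lift_abs free_extend_single)

lemma clinear_tensor_lift:
  assumes "cbilinear f"
  shows "clinear (tensor_lift f)"
proof (rule clinearI)
  fix s t and c
  show "tensor_lift f (s + t) = tensor_lift f s + tensor_lift f t"
    by (induction s rule: tensor.abs_induct, induction t rule: tensor.abs_induct)
      (simp add: plus_tensor.abs_eq tensor_lift_abs[OF assms] clinear_add[OF clinear_free_extend])
  show "tensor_lift f (c *\<^sub>C t) = c *\<^sub>C tensor_lift f t"
    by (induction t rule: tensor.abs_induct)
      (simp add: scaleC_tensor.abs_eq tensor_lift_abs[OF assms]
        clinear_scaleC[OF clinear_free_extend])
qed

(* Left multiplication by a \<otimes> b, that is (a \<otimes> b) (c \<otimes> d) = (a c) \<otimes> (b d). *)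
definition tensor_lmult :: "'a::complex_algebra_1 \<Rightarrow> 'b::complex_algebra_1
    \<Rightarrow> ('a, 'b) tensor \<Rightarrow> ('a, 'b) tensor" where
  "tensor_lmult a b = tensor_lift (\<lambda>c d. (a * c) \<otimes> (b * d))"

definition tensor_mult :: "('a::complex_algebra_1, 'b::complex_algebra_1) tensor
    \<Rightarrow> ('a, 'b) tensor \<Rightarrow> ('a, 'b) tensor" where
  "tensor_mult s t = tensor_lift (\<lambda>a b. tensor_lmult a b t) s"

lemma cbilinear_mult_inner:
  fixes a :: "'a::complex_algebra_1" and b :: "'b::complex_algebra_1"
  shows "cbilinear (\<lambda>c d. (a * c) \<otimes> (b * d))"
  by (simp add: cbilinear_def clinear_iff distrib_left mult_scaleC_right
      tens_add_left tens_add_right tens_scaleC_left tens_scaleC_right)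

lemma tensor_lmult_tens: "tensor_lmult a b (c \<otimes> d) = (a * c) \<otimes> (b * d)"
  unfolding tensor_lmult_def by (rule tensor_lift_tens[OF cbilinear_mult_inner])

lemma clinear_tensor_lmult: "clinear (tensor_lmult a b)"
  unfolding tensor_lmult_def by (rule clinear_tensor_lift[OF cbilinear_mult_inner])

lemma cbilinear_mult_outer: "cbilinear (\<lambda>a b. tensor_lmult a b t)"
  unfolding cbilinear_def clinear_iff
  by (intro conjI allI; induction t rule: tensor_induct)
    (simp_all add: tensor_lmult_tens clinear_add[OF clinear_tensor_lmult] distrib_right
      mult_scaleC_left tens_add_left tens_add_right tens_scaleC_left tens_scaleC_right
      scaleC_add_right add_ac)

lemma tensor_mult_pure: "tensor_mult (a \<otimes> b) t = tensor_lmult a b t"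
  unfolding tensor_mult_def by (rule tensor_lift_tens[OF cbilinear_mult_outer])

lemma tensor_mult_tens: "tensor_mult (a \<otimes> b) (c \<otimes> d) = (a * c) \<otimes> (b * d)"
  by (simp add: tensor_mult_pure tensor_lmult_tens)

lemma tensor_mult_linear_left:
  "tensor_mult (s + s') t = tensor_mult s t + tensor_mult s' t"
  "tensor_mult (k *\<^sub>C s) t = k *\<^sub>C tensor_mult s t"
  unfolding tensor_mult_def
  by (simp_all add: clinear_add[OF clinear_tensor_lift[OF cbilinear_mult_outer]]
      clinear_scaleC[OF clinear_tensor_lift[OF cbilinear_mult_outer]])

lemma tensor_mult_linear_right:
  "tensor_mult s (t + t') = tensor_mult s t + tensor_mult s t'"
  "tensor_mult s (k *\<^sub>C t) = k *\<^sub>C tensor_mult s t"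
  by (induction s rule: tensor_induct)
    (simp_all add: tensor_mult_pure clinear_add[OF clinear_tensor_lmult]
      clinear_scaleC[OF clinear_tensor_lmult] tensor_mult_linear_left scaleC_add_right add_ac)

instantiation tensor :: (complex_algebra_1, complex_algebra_1) complex_algebra_1
begin
definition "1 = 1 \<otimes> 1"
definition "s * t = tensor_mult s t"
instance
proof standard
  fix r s t :: "('a, 'b) tensor" and k
  note linear = tensor_mult_linear_left tensor_mult_linear_right
  have assoc: "tensor_mult (tensor_mult (a \<otimes> b) (c \<otimes> d)) t
      = tensor_mult (a \<otimes> b) (tensor_mult (c \<otimes> d) t)" for a c :: 'a and b d :: 'b
    by (induction t rule: tensor_induct) (simp_all add: tensor_mult_tens linear mult.assoc)
  have assoc': "tensor_mult (tensor_mult (a \<otimes> b) s) t = tensor_mult (a \<otimes> b) (tensor_mult s t)"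
    for a :: 'a and b :: 'b
    by (induction s rule: tensor_induct) (simp_all add: assoc linear)
  show "r * s * t = r * (s * t)"
    unfolding times_tensor_def
    by (induction r rule: tensor_induct) (simp_all add: assoc' linear)
  show "1 * t = t"
    unfolding times_tensor_def one_tensor_def
    by (induction t rule: tensor_induct) (simp_all add: tensor_mult_tens linear)
  show "t * 1 = t"
    unfolding times_tensor_def one_tensor_def
    by (induction t rule: tensor_induct) (simp_all add: tensor_mult_tens linear)
qed (simp_all add: times_tensor_def tensor_mult_linear_left tensor_mult_linear_right)
end

lemma tens_mult_tens: "(a \<otimes> b) * (c \<otimes> d) = (a * c) \<otimes> (b * d)"
  by (simp add: times_tensor_def tensor_mult_tens)


section \<open>The classical Yang--Baxter equation\<close>

type_synonym 'a uea3 = "(('a uea, 'a uea) tensor, 'a uea) tensor"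

definition leg12 :: "('a::complex_lie_algebra, 'a) tensor \<Rightarrow> 'a uea3" where
  "leg12 r = tensor_lift (\<lambda>a b. uea_embed a \<otimes> uea_embed b \<otimes> 1) r"

definition leg13 :: "('a::complex_lie_algebra, 'a) tensor \<Rightarrow> 'a uea3" where
  "leg13 r = tensor_lift (\<lambda>a b. uea_embed a \<otimes> 1 \<otimes> uea_embed b) r"

definition leg23 :: "('a::complex_lie_algebra, 'a) tensor \<Rightarrow> 'a uea3" where
  "leg23 r = tensor_lift (\<lambda>a b. 1 \<otimes> uea_embed a \<otimes> uea_embed b) r"

lemma cbilinear_legs:
  "cbilinear (\<lambda>a b. uea_embed a \<otimes> uea_embed b \<otimes> (1 :: 'a::complex_lie_algebra uea))"
  "cbilinear (\<lambda>a b. uea_embed a \<otimes> (1 :: 'a uea) \<otimes> uea_embed b)"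
  "cbilinear (\<lambda>a b. (1 :: 'a uea) \<otimes> uea_embed a \<otimes> uea_embed b)"
  by (simp_all add: cbilinear_def clinear_iff clinear_add[OF clinear_uea_embed]
      clinear_scaleC[OF clinear_uea_embed] tens_add_left tens_add_right
      tens_scaleC_left tens_scaleC_right)

lemma legs_sum:
  fixes a b :: "'i \<Rightarrow> 'a::complex_lie_algebra"
  shows
  "leg12 (\<Sum>i\<in>I. a i \<otimes> b i) = (\<Sum>i\<in>I. uea_embed (a i) \<otimes> uea_embed (b i) \<otimes> 1)"
  "leg13 (\<Sum>i\<in>I. a i \<otimes> b i) = (\<Sum>i\<in>I. uea_embed (a i) \<otimes> 1 \<otimes> uea_embed (b i))"
  "leg23 (\<Sum>i\<in>I. a i \<otimes> b i) = (\<Sum>i\<in>I. 1 \<otimes> uea_embed (a i) \<otimes> uea_embed (b i))"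
proof -
  have *: "tensor_lift f (\<Sum>i\<in>I. a i \<otimes> b i) = (\<Sum>i\<in>I. f (a i) (b i))"
    if "cbilinear f" for f :: "'a \<Rightarrow> 'a \<Rightarrow> 'a uea3"
    by (induction I rule: infinite_finite_induct)
      (simp_all add: clinear_zero[OF clinear_tensor_lift[OF that]]
        clinear_add[OF clinear_tensor_lift[OF that]] tensor_lift_tens[OF that])
  show "leg12 (\<Sum>i\<in>I. a i \<otimes> b i) = (\<Sum>i\<in>I. uea_embed (a i) \<otimes> uea_embed (b i) \<otimes> 1)"
    "leg13 (\<Sum>i\<in>I. a i \<otimes> b i) = (\<Sum>i\<in>I. uea_embed (a i) \<otimes> 1 \<otimes> uea_embed (b i))"
    "leg23 (\<Sum>i\<in>I. a i \<otimes> b i) = (\<Sum>i\<in>I. 1 \<otimes> uea_embed (a i) \<otimes> uea_embed (b i))"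
    unfolding leg12_def leg13_def leg23_def by (rule *[OF cbilinear_legs(1)]
      *[OF cbilinear_legs(2)] *[OF cbilinear_legs(3)])+
qed

definition commutator :: "'a::complex_algebra_1 \<Rightarrow> 'a \<Rightarrow> 'a" where
  "commutator x y = x * y - y * x"

definition cybe_solution :: "('a::complex_lie_algebra, 'a) tensor \<Rightarrow> bool" where
  "cybe_solution r \<longleftrightarrow>
     commutator (leg12 r) (leg13 r) + commutator (leg12 r) (leg23 r)
       + commutator (leg13 r) (leg23 r) = 0"

end

theory Submission
  imports Defs
begin

text \<open>Each of the six tensors has the form \<open>r = a \<otimes> b - b \<otimes> a\<close> with
  \<open>[a, b] = c b\<close> for some scalar \<open>c\<close>: for \<open>r\<^sub>2\<close> and \<open>r\<^sub>6\<close> the two vectors paired with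
  \<open>e\<^sub>2\<^sup>*\<close> and \<open>e\<^sub>3\<^sup>*\<close> are proportional, and in the other cases \<open>a\<close> and \<open>b\<close> commute. Every such
  tensor solves the classical Yang--Baxter equation.\<close>

lemma tens_diff_left: "(a - a') \<otimes> b = a \<otimes> b - a' \<otimes> b"
  by (metis add_diff_cancel_right' diff_add_cancel tens_add_left)

lemma tens_diff_right: "a \<otimes> (b - b') = a \<otimes> b - a \<otimes> b'"
  by (metis add_diff_cancel_right' diff_add_cancel tens_add_right)

lemmas tens_linear = tens_add_left tens_add_right tens_diff_left tens_diff_right
  tens_scaleC_left tens_scaleC_right

lemma bracket_zero_right [simp]: "bracket (x::'a::complex_lie_algebra) 0 = 0"
  by (rule clinear_zero[OF clinear_bracket])

lemma bracket_diff_left: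
  "bracket (x - y) z = bracket x z - bracket y (z::'a::complex_lie_algebra)"
  by (metis add_diff_cancel_right' bracket_add_left diff_add_cancel)

lemma coad_zero_left [simp]: "coad 0 \<xi> = 0"
  using coad_scaleC_left[of 0 0 \<xi>] by simp

lemma coad_zero_right [simp]: "coad x 0 = 0"
  using coad_scaleC_right[of x 0 0] by simp

text \<open>With \<open>[a, b] = c b\<close>, the commutators of legs 12 and 13, 12 and 23, 13 and
  23 are \<open>c\<close> times b \<otimes> a \<otimes> b - b \<otimes> b \<otimes> a, b \<otimes> b
  \<otimes> a - a \<otimes> b \<otimes> b and a \<otimes> b \<otimes> b - b \<otimes> a \<otimes> b.
  Their sum telescopes to zero.\<close>

lemma cybe_solution_wedge:
  fixes a b :: "'a::complex_lie_algebra"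
  assumes "bracket a b = c *\<^sub>C b"
  shows "cybe_solution (a \<otimes> b - b \<otimes> a)"
proof -
  let ?A = "uea_embed a" and ?B = "uea_embed b"
  \<comment> \<open>Used as a rewrite rule, this moves \<open>?B\<close> to the left of
    \<open>?A\<close>, so all products in the three commutators reach one normal form and
    cancel.\<close>
  have AB: "?A * ?B = ?B * ?A + c *\<^sub>C ?B"
    using uea_embed_bracket[of a b] by (simp add: assms clinear_scaleC[OF clinear_uea_embed])
  have legs:
    "leg12 (a \<otimes> b - b \<otimes> a) = ?A \<otimes> ?B \<otimes> 1 - ?B \<otimes> ?A \<otimes> 1"
    "leg13 (a \<otimes> b - b \<otimes> a) = ?A \<otimes> 1 \<otimes> ?B - ?B \<otimes> 1 \<otimes> ?A"
    "leg23 (a \<otimes> b - b \<otimes> a) = 1 \<otimes> ?A \<otimes> ?B - 1 \<otimes> ?B \<otimes> ?A"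
    unfolding leg12_def leg13_def leg23_def
    by (simp_all add: clinear_diff[OF clinear_tensor_lift] cbilinear_legs tensor_lift_tens)
  show ?thesis
    unfolding cybe_solution_def commutator_def legs
    by (simp add: left_diff_distrib right_diff_distrib tens_mult_tens AB tens_linear)
qed

text \<open>Serves two comparisons on a basis: of two functionals, and of the identity with the
  expansion in coordinates.\<close>

lemma clinear_eq_on_span:
  assumes "clinear f" "clinear g" "\<And>x. x \<in> B \<Longrightarrow> f x = g x" "x \<in> cvs.span B"
  shows "f x = g x"
  using assms(4)
  by (induction rule: cvs.span_induct_alt)
    (simp_all add: assms(3) clinear_zero[OF assms(1)] clinear_zero[OF assms(2)]
      clinear_add[OF assms(1)] clinear_add[OF assms(2)]
      clinear_scaleC[OF assms(1)] clinear_scaleC[OF assms(2)])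

lemma dual_eq_on_spanning:
  assumes "cvs.span B = UNIV" "\<And>x. x \<in> B \<Longrightarrow> dual_apply \<xi> x = dual_apply \<eta> x"
  shows "\<xi> = \<eta>"
  using clinear_eq_on_span[OF clinear_dual_apply clinear_dual_apply assms(2)] assms(1)
  by (intro dual_eqI) auto

theorem proposition5p19:
  fixes e1 e2 e3 :: "'g::complex_lie_algebra" and f1 f2 f3 :: "'g dual"
  assumes basis: "distinct [e1, e2, e3]" "cvs.independent {e1, e2, e3}"
      "cvs.span {e1, e2, e3} = UNIV"
    and brackets: "bracket e1 e2 = 0" "bracket e1 e3 = 0" "bracket e2 e3 = e2"
    and dual_basis:
      "dual_apply f1 e1 = 1" "dual_apply f1 e2 = 0" "dual_apply f1 e3 = 0"
      "dual_apply f2 e1 = 0" "dual_apply f2 e2 = 1" "dual_apply f2 e3 = 0"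
      "dual_apply f3 e1 = 0" "dual_apply f3 e2 = 0" "dual_apply f3 e3 = 1"
  shows "let E1 = of_lie e1; E2 = of_lie e2; E3 = of_lie e3;
             F1 = of_dual f1; F2 = of_dual f2; F3 = of_dual f3
    in distinct [E1, E2, E3, F1, F2, F3]
     \<and> cvs.independent {E1, E2, E3, F1, F2, F3}
     \<and> cvs.span {E1, E2, E3, F1, F2, F3} = UNIV
     \<and> bracket E2 E3 = E2 \<and> bracket E2 F2 = - F3 \<and> bracket E3 F2 = F2
     \<and> bracket E1 E2 = 0 \<and> bracket E1 E3 = 0
     \<and> bracket E1 F1 = 0 \<and> bracket E1 F2 = 0 \<and> bracket E1 F3 = 0
     \<and> bracket E2 F1 = 0 \<and> bracket E2 F3 = 0
     \<and> bracket E3 F1 = 0 \<and> bracket E3 F3 = 0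
     \<and> bracket F1 F2 = 0 \<and> bracket F1 F3 = 0 \<and> bracket F2 F3 = 0
     \<and> (\<forall>n32 :: complex. cybe_solution ((n32 *\<^sub>C E2) \<otimes> F3 - F3 \<otimes> (n32 *\<^sub>C E2)))
     \<and> (\<forall>n22 n23 :: complex. n23 \<noteq> 0 \<longrightarrow> cybe_solution
          ((n22 *\<^sub>C E2 + n23 *\<^sub>C E3) \<otimes> F2
           - ((n22\<^sup>2 / n23) *\<^sub>C E2 + n22 *\<^sub>C E3) \<otimes> F3
           - F2 \<otimes> (n22 *\<^sub>C E2 + n23 *\<^sub>C E3)
           + F3 \<otimes> ((n22\<^sup>2 / n23) *\<^sub>C E2 + n22 *\<^sub>C E3)))
     \<and> (\<forall>n31 n32 :: complex. n31 \<noteq> 0 \<longrightarrow> cybe_solution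
          ((n31 *\<^sub>C E1 + n32 *\<^sub>C E2) \<otimes> F3 - F3 \<otimes> (n31 *\<^sub>C E1 + n32 *\<^sub>C E2)))
     \<and> (\<forall>n21 n31 :: complex. n21 \<noteq> 0 \<longrightarrow> cybe_solution
          ((n21 *\<^sub>C E1) \<otimes> F2 + (n31 *\<^sub>C E1) \<otimes> F3
           - F2 \<otimes> (n21 *\<^sub>C E1) - F3 \<otimes> (n31 *\<^sub>C E1)))
     \<and> (\<forall>n12 n32 :: complex. n12 \<noteq> 0 \<longrightarrow> cybe_solution
          ((n12 *\<^sub>C E2) \<otimes> F1 + (n32 *\<^sub>C E2) \<otimes> F3
           - F1 \<otimes> (n12 *\<^sub>C E2) - F3 \<otimes> (n32 *\<^sub>C E2)))
     \<and> (\<forall>n21 n31 :: complex. n21 \<noteq> 0 \<longrightarrow>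
          (let u = n21 *\<^sub>C E1 - n31 *\<^sub>C E2 + n21 *\<^sub>C E3;
               v = n31 *\<^sub>C E1 - (n31\<^sup>2 / n21) *\<^sub>C E2 + n31 *\<^sub>C E3
           in cybe_solution (u \<otimes> F2 + v \<otimes> F3 - F2 \<otimes> u - F3 \<otimes> v)))"
proof -
  let ?B = "{e1, e2, e3}"
  have dual_eq: "\<xi> = \<eta>" if "dual_apply \<xi> e1 = dual_apply \<eta> e1"
    "dual_apply \<xi> e2 = dual_apply \<eta> e2" "dual_apply \<xi> e3 = dual_apply \<eta> e3" for \<xi> \<eta> :: "'g dual"
    using dual_eq_on_spanning[OF basis(3)] that by blast
  note dual_simps = dual_basis coad.rep_eq uminus_dual.rep_eq zero_dual.rep_eq plus_dual.rep_eq
    scaleC_dual.rep_eq scaleC_complex_def clinear_zero[OF clinear_dual_apply]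
    clinear_neg[OF clinear_dual_apply] clinear_add[OF clinear_dual_apply]
    clinear_scaleC[OF clinear_dual_apply]
  have brackets': "bracket e2 e1 = 0" "bracket e3 e1 = 0" "bracket e3 e2 = - e2"
    using brackets bracket_skew[of e2 e1] bracket_skew[of e3 e1] bracket_skew[of e3 e2] by simp_all
  \<comment> \<open>\<open>f1\<close> and \<open>f3\<close> vanish on every bracket, since all
    brackets are multiples of \<open>e2\<close>; only \<open>f2\<close> is moved. Its images come
    from \<open>- f2 (bracket e2 e3) = -1\<close> and
    \<open>- f2 (bracket e3 e2) = 1\<close>.\<close>
  have coads: "coad e1 f1 = 0" "coad e1 f2 = 0" "coad e1 f3 = 0"
    "coad e2 f1 = 0" "coad e2 f2 = - f3" "coad e2 f3 = 0"
    "coad e3 f1 = 0" "coad e3 f2 = f2" "coad e3 f3 = 0"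
    by (rule dual_eq; simp add: dual_simps brackets brackets' bracket_self)+

  \<comment> \<open>As opaque names, the six vectors enter the tensor computations only through the
    bracket table \<open>brs\<close>.\<close>
  define E1 E2 E3 F1 F2 F3 where defs: "E1 = of_lie e1" "E2 = of_lie e2" "E3 = of_lie e3"
    "F1 = of_dual f1" "F2 = of_dual f2" "F3 = of_dual f3"
  note semi_simps = defs of_lie_def of_dual_def zero_semi_def plus_semi_def uminus_semi_def
    scaleC_semi_def
  have brs: "bracket E2 E3 = E2" "bracket E2 F2 = - F3" "bracket E3 F2 = F2"
    "bracket E1 E2 = 0" "bracket E1 E3 = 0"
    "bracket E1 F1 = 0" "bracket E1 F2 = 0" "bracket E1 F3 = 0"
    "bracket E2 F1 = 0" "bracket E2 F3 = 0" "bracket E3 F1 = 0" "bracket E3 F3 = 0"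
    "bracket F1 F2 = 0" "bracket F1 F3 = 0" "bracket F2 F3 = 0"
    by (simp_all add: semi_simps bracket_semi_def brackets coads)

  have coords: "c1 = 0 \<and> c2 = 0 \<and> c3 = 0 \<and> d1 = 0 \<and> d2 = 0 \<and> d3 = 0"
    if "c1 *\<^sub>C E1 + c2 *\<^sub>C E2 + c3 *\<^sub>C E3 + d1 *\<^sub>C F1 + d2 *\<^sub>C F2 + d3 *\<^sub>C F3 = 0"
    for c1 c2 c3 d1 d2 d3
  proof -
    \<comment> \<open>The two components of a vanishing element vanish separately; pairing them with
      the dual basis and the basis then isolates each coefficient.\<close>
    have x: "c1 *\<^sub>C e1 + c2 *\<^sub>C e2 + c3 *\<^sub>C e3 = 0"
      and \<xi>: "d1 *\<^sub>C f1 + d2 *\<^sub>C f2 + d3 *\<^sub>C f3 = 0"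
      using that by (simp_all add: semi_simps)
    have "dual_apply f (c1 *\<^sub>C e1 + c2 *\<^sub>C e2 + c3 *\<^sub>C e3) = 0" for f
      by (simp add: x dual_simps)
    from this[of f1] this[of f2] this[of f3]
    have "c1 = 0" "c2 = 0" "c3 = 0"
      by (simp_all add: dual_simps)
    moreover have "dual_apply (d1 *\<^sub>C f1 + d2 *\<^sub>C f2 + d3 *\<^sub>C f3) e = 0" for e
      by (simp add: \<xi> dual_simps)
    from this[of e1] this[of e2] this[of e3]
    have "d1 = 0" "d2 = 0" "d3 = 0"
      by (simp_all add: dual_simps)
    ultimately show ?thesis by simp
  qed
  have nz: "f1 \<noteq> 0" "f2 \<noteq> 0" "f3 \<noteq> 0" "e1 \<noteq> 0" "e2 \<noteq> 0" "e3 \<noteq> 0"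
    "f1 \<noteq> f2" "f1 \<noteq> f3" "f2 \<noteq> f3"
    by (metis dual_basis zero_dual.rep_eq clinear_zero[OF clinear_dual_apply] zero_neq_one)+
  \<comment> \<open>An \<open>E\<close> differs from an \<open>F\<close> because their nonzero
    entries lie in different components.\<close>
  have dist: "distinct [E1, E2, E3, F1, F2, F3]"
    using nz basis(1) by (simp add: semi_simps)
  have indep: "cvs.independent {E1, E2, E3, F1, F2, F3}"
  proof (rule cvs.independent_if_scalars_zero)
    fix g v
    assume "(\<Sum>x\<in>{E1, E2, E3, F1, F2, F3}. g x *\<^sub>C x) = 0" "v \<in> {E1, E2, E3, F1, F2, F3}"
    \<comment> \<open>Distinctness makes the sum over the set split into the six summands of
      \<open>coords\<close>.\<close>
    then show "g v = 0"
      using coords[of "g E1" "g E2" "g E3" "g F1" "g F2" "g F3"] dist by (auto simp: add_ac)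
  qed simp
  have span: "p \<in> cvs.span {E1, E2, E3, F1, F2, F3}" for p
  proof (cases p)
    case (Semi x \<xi>)
    \<comment> \<open>The coordinates of \<open>x\<close> are the values \<open>f1 x\<close>,
      \<open>f2 x\<close>, \<open>f3 x\<close>: the map \<open>?g\<close> is linear and fixes each
      basis vector, so it is the identity. Dually, the coordinates of \<open>\<xi>\<close> are its
      values on the basis.\<close>
    let ?g = "\<lambda>x. dual_apply f1 x *\<^sub>C e1 + dual_apply f2 x *\<^sub>C e2 + dual_apply f3 x *\<^sub>C e3"
    have "clinear ?g"
      by (rule clinearI) (simp_all add: dual_simps scaleC_add_left scaleC_add_right scaleC_scaleC)
    moreover have "clinear (\<lambda>x :: 'g. x)"
      by (simp add: clinear_iff)
    moreover have "y = ?g y" if "y \<in> ?B" for y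
      using that by (auto simp: dual_basis scaleC_one)
    ultimately have x: "x = ?g x"
      using clinear_eq_on_span[of "\<lambda>x. x" ?g ?B x] basis(3) by auto
    have \<xi>: "\<xi> = dual_apply \<xi> e1 *\<^sub>C f1 + dual_apply \<xi> e2 *\<^sub>C f2 + dual_apply \<xi> e3 *\<^sub>C f3"
      by (rule dual_eq) (simp_all add: dual_simps)
    have "p = dual_apply f1 x *\<^sub>C E1 + dual_apply f2 x *\<^sub>C E2 + dual_apply f3 x *\<^sub>C E3
        + dual_apply \<xi> e1 *\<^sub>C F1 + dual_apply \<xi> e2 *\<^sub>C F2 + dual_apply \<xi> e3 *\<^sub>C F3"
      using x \<xi> by (simp add: semi_simps Semi)
    then show ?thesis
      by (auto intro!: cvs.span_add cvs.span_scale intro: cvs.span_base)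
  qed

  note vec_simps = bracket_add_left bracket_add_right bracket_diff_left bracket_scaleC_left
    bracket_scaleC_right brs cvs.scale_right_diff_distrib cvs.scale_minus_right scaleC_add_right
    scaleC_scaleC
  have r1: "cybe_solution ((n32 *\<^sub>C E2) \<otimes> F3 - F3 \<otimes> (n32 *\<^sub>C E2))" for n32
    by (rule cybe_solution_wedge[of _ _ 0]) (simp add: vec_simps)
  have r2: "cybe_solution
      ((n22 *\<^sub>C E2 + n23 *\<^sub>C E3) \<otimes> F2 - ((n22\<^sup>2 / n23) *\<^sub>C E2 + n22 *\<^sub>C E3) \<otimes> F3
       - F2 \<otimes> (n22 *\<^sub>C E2 + n23 *\<^sub>C E3) + F3 \<otimes> ((n22\<^sup>2 / n23) *\<^sub>C E2 + n22 *\<^sub>C E3))"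
    if "n23 \<noteq> 0" for n22 n23
  proof -
    \<comment> \<open>The vector paired with \<open>F3\<close> is \<open>n22 / n23\<close> times
      \<open>?a\<close>; moving that scalar across the tensor sign collects the dual factors into
      \<open>?b\<close>.\<close>
    let ?a = "n22 *\<^sub>C E2 + n23 *\<^sub>C E3" and ?b = "F2 - (n22 / n23) *\<^sub>C F3"
    have "(n22\<^sup>2 / n23) *\<^sub>C E2 + n22 *\<^sub>C E3 = (n22 / n23) *\<^sub>C ?a"
      using that by (simp add: vec_simps power2_eq_square)
    then have "(n22 *\<^sub>C E2 + n23 *\<^sub>C E3) \<otimes> F2 - ((n22\<^sup>2 / n23) *\<^sub>C E2 + n22 *\<^sub>C E3) \<otimes> F3
       - F2 \<otimes> (n22 *\<^sub>C E2 + n23 *\<^sub>C E3) + F3 \<otimes> ((n22\<^sup>2 / n23) *\<^sub>C E2 + n22 *\<^sub>C E3)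
       = ?a \<otimes> ?b - ?b \<otimes> ?a"
      by (simp add: tens_linear vec_simps algebra_simps)
    \<comment> \<open>\<open>E2\<close> sends \<open>F2\<close> to \<open>- F3\<close> and
      \<open>E3\<close> fixes \<open>F2\<close>, while both kill \<open>F3\<close>; so the bracket
      is \<open>n23 *\<^sub>C F2 - n22 *\<^sub>C F3\<close>.\<close>
    moreover have "bracket ?a ?b = n23 *\<^sub>C ?b"
      using that by (simp add: vec_simps clinear_diff[OF clinear_bracket])
    ultimately show ?thesis
      by (metis cybe_solution_wedge)
  qed
  have r3: "cybe_solution
      ((n31 *\<^sub>C E1 + n32 *\<^sub>C E2) \<otimes> F3 - F3 \<otimes> (n31 *\<^sub>C E1 + n32 *\<^sub>C E2))" for n31 n32
    by (rule cybe_solution_wedge[of _ _ 0]) (simp add: vec_simps)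
  have r4: "cybe_solution ((n21 *\<^sub>C E1) \<otimes> F2 + (n31 *\<^sub>C E1) \<otimes> F3
      - F2 \<otimes> (n21 *\<^sub>C E1) - F3 \<otimes> (n31 *\<^sub>C E1))" for n21 n31
    \<comment> \<open>Both scalars move to the dual factor, leaving a wedge with \<open>E1\<close>,
      which commutes with \<open>F2\<close> and \<open>F3\<close>.\<close>
    using cybe_solution_wedge[of E1 "n21 *\<^sub>C F2 + n31 *\<^sub>C F3" 0]
    by (simp add: vec_simps tens_linear algebra_simps)
  have r5: "cybe_solution ((n12 *\<^sub>C E2) \<otimes> F1 + (n32 *\<^sub>C E2) \<otimes> F3
      - F1 \<otimes> (n12 *\<^sub>C E2) - F3 \<otimes> (n32 *\<^sub>C E2))" for n12 n32
    \<comment> \<open>The same regrouping, now with \<open>E2\<close>, which commutes with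
      \<open>F1\<close> and \<open>F3\<close>.\<close>
    using cybe_solution_wedge[of E2 "n12 *\<^sub>C F1 + n32 *\<^sub>C F3" 0]
    by (simp add: vec_simps tens_linear algebra_simps)
  \<comment> \<open>The equations for \<open>u\<close> and \<open>v\<close> are premises so that
    reflexivity instantiates them with the unfolded \<open>let\<close> terms of the goal.\<close>
  have r6: "cybe_solution (u \<otimes> F2 + v \<otimes> F3 - F2 \<otimes> u - F3 \<otimes> v)"
    if "n21 \<noteq> 0" and u: "u = n21 *\<^sub>C E1 - n31 *\<^sub>C E2 + n21 *\<^sub>C E3"
      and v: "v = n31 *\<^sub>C E1 - (n31\<^sup>2 / n21) *\<^sub>C E2 + n31 *\<^sub>C E3" for n21 n31 u v
  proof -
    \<comment> \<open>As \<open>v\<close> is \<open>n31 / n21\<close> times \<open>u\<close>, this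
      is the dual factor left after pulling out \<open>u\<close>. Bracketing with \<open>u\<close>
      gives \<open>n31 *\<^sub>C F3 + n21 *\<^sub>C F2\<close>, an \<open>n21\<close>-multiple of
      \<open>?b\<close>.\<close>
    let ?b = "F2 + (n31 / n21) *\<^sub>C F3"
    have "v = (n31 / n21) *\<^sub>C u"
      using that(1) by (simp add: u v vec_simps power2_eq_square)
    then have "u \<otimes> F2 + v \<otimes> F3 - F2 \<otimes> u - F3 \<otimes> v = u \<otimes> ?b - ?b \<otimes> u"
      by (simp add: tens_linear algebra_simps)
    moreover have "bracket u ?b = n21 *\<^sub>C ?b"
      using that(1) by (simp add: u vec_simps)
    ultimately show ?thesis
      by (metis cybe_solution_wedge)
  qed
  show ?thesis
    unfolding Let_def defs[symmetric]
    by (intro conjI allI impI dist indep brs r1 r2 r3 r4 r5 r6[OF _ refl refl])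
      (use span in auto)
qed

end
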